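(* Let $N,M\ge 1$ be integers, $\sigma>0$ and $|\rho|<1$ real. Let $x_{0n},y_{0n}$ ($1\le n\le N$) and $x_{mn},y_{mn}$ ($2\le m\le M$, $1\le n\le N$) be mutually independent real Gaussian random variables with mean $0$ and variance $1/2$. Define $h_{1n}=\sigma x_{0n}+j\sigma y_{0n}$ and, for $2\le m\le M$, $h_{mn}=\sigma(\sqrt{1-\rho^2}\,x_{mn}+\rho x_{0n})+j\sigma(\sqrt{1-\rho^2}\,y_{mn}+\rho y_{0n})$, where $j$ is the imaginary unit. Let $X_m=\sum_{n=1}^N|h_{mn}|^2$ for $1\le m\le M$ and $X_{\rm FAS}=\max\{X_1,\dots,X_M\}$. Then for every threshold $\gamma_{th}>0$ the outage probability $P_{\rm out}(\gamma_{th})=\Pr(X_{\rm FAS}<\gamma_{th})$ equals $$P_{\rm out}(\gamma_{th})=\int_0^{\gamma_{th}}\frac{t_1^{N-1}}{\sigma^{2N}(N-1)!}e^{-\frac{t_1}{\sigma^2}}\left(1-Q_N\!\left(\sqrt{\frac{2\rho^2t_1}{\sigma^2(1-\rho^2)}},\sqrt{\frac{2\gamma_{th}}{\sigma^2(1-\rho^2)}}\right)\right)^{M-1}dt_1 .$$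
   Context: For an integer $\nu\ge1$, $Q_\nu$ is the generalized Marcum $Q$-function: for $a>0$, $b\ge0$, $Q_\nu(a,b)=\int_b^\infty x\left(\frac{x}{a}\right)^{\nu-1}e^{-\frac{x^2+a^2}{2}}I_{\nu-1}(ax)\,dx$, where $I_{\nu-1}$ is the modified Bessel function of the first kind, and $Q_\nu(0,b)$ is the limit as $a\to0^+$, i.e. $Q_\nu(0,b)=\frac{1}{(\nu-1)!}\int_{b^2/2}^\infty s^{\nu-1}e^{-s}ds$. *)

theory Defs
  imports "HOL-Probability.Probability"
begin

text \<open>
  Modified Bessel function of the first kind of integer order \<open>n \<ge> 0\<close>, by its power series;
  the Gamma factor of the general series is \<open>(k + n)!\<close> here.
\<close>

definition bessel_I :: "nat \<Rightarrow> real \<Rightarrow> real" where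
  "bessel_I n z = (\<Sum>k. (z / 2) ^ (2 * k + n) / (fact k * fact (k + n)))"

text \<open>
  Generalized Marcum Q-function of integer order \<open>\<nu> \<ge> 1\<close>, for \<open>a \<ge> 0\<close> and \<open>b \<ge> 0\<close>.
  The value at \<open>a = 0\<close> is the limit of the general expression as \<open>a\<close> tends to 0 from the right.
\<close>

definition marcum_Q :: "nat \<Rightarrow> real \<Rightarrow> real \<Rightarrow> real" where
  "marcum_Q \<nu> a b =
     (if a = 0
      then 1 / fact (\<nu> - 1) * (LBINT s:{b\<^sup>2 / 2..}. s ^ (\<nu> - 1) * exp (- s))
      else (LBINT x:{b..}. x * (x / a) ^ (\<nu> - 1) * exp (- (x\<^sup>2 + a\<^sup>2) / 2)
                             * bessel_I (\<nu> - 1) (a * x)))"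

definition fas_channel ::
  "real \<Rightarrow> real \<Rightarrow> (nat \<Rightarrow> nat \<Rightarrow> 'a \<Rightarrow> real) \<Rightarrow> (nat \<Rightarrow> nat \<Rightarrow> 'a \<Rightarrow> real)
     \<Rightarrow> nat \<Rightarrow> nat \<Rightarrow> 'a \<Rightarrow> complex" where
  "fas_channel \<sigma> \<rho> x y m n \<omega> =
     (if m = 1
      then complex_of_real (\<sigma> * x 0 n \<omega>) + \<i> * complex_of_real (\<sigma> * y 0 n \<omega>)
      else complex_of_real (\<sigma> * (sqrt (1 - \<rho>\<^sup>2) * x m n \<omega> + \<rho> * x 0 n \<omega>))
           + \<i> * complex_of_real (\<sigma> * (sqrt (1 - \<rho>\<^sup>2) * y m n \<omega> + \<rho> * y 0 n \<omega>)))"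

definition fas_port_gain ::
  "nat \<Rightarrow> real \<Rightarrow> real \<Rightarrow> (nat \<Rightarrow> nat \<Rightarrow> 'a \<Rightarrow> real) \<Rightarrow> (nat \<Rightarrow> nat \<Rightarrow> 'a \<Rightarrow> real)
     \<Rightarrow> nat \<Rightarrow> 'a \<Rightarrow> real" where
  "fas_port_gain N \<sigma> \<rho> x y m \<omega> = (\<Sum>n = 1..N. (cmod (fas_channel \<sigma> \<rho> x y m n \<omega>))\<^sup>2)"

definition fas_gain ::
  "nat \<Rightarrow> nat \<Rightarrow> real \<Rightarrow> real \<Rightarrow> (nat \<Rightarrow> nat \<Rightarrow> 'a \<Rightarrow> real) \<Rightarrow> (nat \<Rightarrow> nat \<Rightarrow> 'a \<Rightarrow> real)
     \<Rightarrow> 'a \<Rightarrow> real" where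
  "fas_gain N M \<sigma> \<rho> x y \<omega> = Max ((\<lambda>m. fas_port_gain N \<sigma> \<rho> x y m \<omega>) ` {1..M})"

definition outage_prob ::
  "'a measure \<Rightarrow> nat \<Rightarrow> nat \<Rightarrow> real \<Rightarrow> real \<Rightarrow> (nat \<Rightarrow> nat \<Rightarrow> 'a \<Rightarrow> real)
     \<Rightarrow> (nat \<Rightarrow> nat \<Rightarrow> 'a \<Rightarrow> real) \<Rightarrow> real \<Rightarrow> real" where
  "outage_prob P N M \<sigma> \<rho> x y \<gamma> = measure P {\<omega> \<in> space P. fas_gain N M \<sigma> \<rho> x y \<omega> < \<gamma>}"

text \<open>Index pairs \<open>(m, n)\<close> of the underlying Gaussian variables; \<open>m = 1\<close> does not occur.\<close>

definition gauss_index :: "nat \<Rightarrow> nat \<Rightarrow> (nat \<times> nat) set" where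
  "gauss_index N M = insert 0 {2..M} \<times> {1..N}"

end

theory Submission
  imports Defs
begin

text \<open>
  If \<open>Z\<close> is normal with mean 0 and variance 1/2, then \<open>(Z + \<mu>)\<^sup>2\<close> has the density of a Poisson mixture,
  with rate \<open>\<mu>\<^sup>2\<close>, of Gamma distributions with shapes \<open>1/2 + k\<close>. Such mixtures are closed under
  convolution: shapes and rates add. Hence a sum of \<open>2 N\<close> independent shifted squares follows the
  mixture with shape \<open>N\<close> and rate the sum of the squared shifts, whose density becomes the
  integrand of the Marcum function under the substitution \<open>s = x\<^sup>2 / 2\<close>. Conditionally on the
  variables of the reference port, the gains of the other ports are independent, and each has a
  distribution function depending on these variables only through the gain of the first port;
  averaging over this gain gives the formula.
\<close>


section \<open>Gamma densities, their Poisson mixtures, and convolution\<close>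

definition gamma_density :: "real \<Rightarrow> real \<Rightarrow> real" where
  "gamma_density a s = (if 0 < s then s powr (a - 1) * exp (- s) / Gamma a else 0)"

text \<open>This is the law of half a noncentral chi-square variable with \<open>2 * a\<close>
  degrees of freedom and noncentrality \<open>2 * l\<close>. Values in \<open>ennreal\<close> let
  series and integrals be exchanged freely by nonnegativity.\<close>

definition nc_gamma_density :: "real \<Rightarrow> real \<Rightarrow> real \<Rightarrow> ennreal" where
  "nc_gamma_density a l s =
     (\<Sum>k. ennreal (exp (- l) * l ^ k / fact k) * ennreal (gamma_density (a + real k) s))"

lemma gamma_density_nonneg: "0 < a \<Longrightarrow> 0 \<le> gamma_density a s"
  by (simp add: gamma_density_def Gamma_real_pos less_imp_le)

lemma measurable_gamma_density [measurable]: "gamma_density a \<in> borel_measurable borel"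
  unfolding gamma_density_def by measurable

lemma measurable_nc_gamma_density [measurable]:
  "(\<lambda>(l, s). nc_gamma_density a l s) \<in> borel_measurable (borel \<Otimes>\<^sub>M borel)"
  unfolding nc_gamma_density_def by measurable

lemma nn_integral_gamma_density:
  assumes "0 < a" shows "(\<integral>\<^sup>+s. ennreal (gamma_density a s) \<partial>lborel) = 1"
proof -
  have "((\<lambda>t. t powr (a - 1) / exp t / Gamma a) has_integral Gamma a / Gamma a) {0..}"
    by (rule has_integral_divide[OF Gamma_integral_real[OF assms]])
  then have "(\<integral>\<^sup>+t\<in>{0..}. ennreal (t powr (a - 1) / exp t / Gamma a) \<partial>lborel) = ennreal (Gamma a / Gamma a)"
    using assms by (intro nn_integral_has_integral_lebesgue') (auto simp: Gamma_real_pos less_imp_le)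
  moreover have "(\<integral>\<^sup>+s. ennreal (gamma_density a s) \<partial>lborel) =
      (\<integral>\<^sup>+t\<in>{0..}. ennreal (t powr (a - 1) / exp t / Gamma a) \<partial>lborel)"
    by (intro nn_integral_cong_AE AE_I[where N="{0}"])
      (auto simp: gamma_density_def exp_minus field_simps split: split_indicator)
  ultimately show ?thesis using Gamma_real_pos[OF assms] by simp
qed

text \<open>The scaling \<open>y = x * u\<close> turns the convolution into a Beta integral, and
  \<open>Beta b a\<close> trades the two Gamma factors for \<open>Gamma (a + b)\<close>.\<close>

lemma gamma_density_convolution:
  assumes "0 < a" "0 < b"
  shows "(\<integral>\<^sup>+y. ennreal (gamma_density a (x - y)) * ennreal (gamma_density b y) \<partial>lborel) =
    ennreal (gamma_density (a + b) x)"
proof (cases "0 < x")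
  case False
  then have "(\<integral>\<^sup>+y. ennreal (gamma_density a (x - y)) * ennreal (gamma_density b y) \<partial>lborel) = (\<integral>\<^sup>+y. 0 \<partial>(lborel::real measure))"
    by (intro nn_integral_cong) (auto simp: gamma_density_def)
  with False show ?thesis by (simp add: gamma_density_def)
next
  case x: True
  \<comment> \<open>\<open>C\<close> collects everything in the product that is free of
    \<open>u\<close> once \<open>y = x * u\<close>; the Jacobian \<open>x\<close> later raises the
    exponent \<open>a + b - 2\<close> to \<open>a + b - 1\<close>.\<close>
  define C where "C = x powr (a + b - 2) * exp (- x) / (Gamma a * Gamma b)"
  have G: "0 < Gamma a" "0 < Gamma b" using assms by (auto simp: Gamma_real_pos)
  have C: "0 \<le> C" using G by (simp add: C_def)
  have Bp: "Beta b a = Gamma a * Gamma b / Gamma (a + b)" by (simp add: Beta_def add.commute mult.commute)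
  have "(\<integral>\<^sup>+y. ennreal (gamma_density a (x - y)) * ennreal (gamma_density b y) \<partial>lborel)
     = ennreal x * (\<integral>\<^sup>+u. ennreal (gamma_density a (x - x * u)) * ennreal (gamma_density b (x * u)) \<partial>lborel)"
    using x by (subst nn_integral_real_affine[where c=x and t=0]) auto
  also have "(\<integral>\<^sup>+u. ennreal (gamma_density a (x - x * u)) * ennreal (gamma_density b (x * u)) \<partial>lborel)
    = (\<integral>\<^sup>+u. ennreal (C * (u powr (b - 1) * (1 - u) powr (a - 1))) * indicator {0..1} u \<partial>lborel)"
  proof (rule nn_integral_cong_AE)
    have eq: "ennreal (gamma_density a (x - x * u)) * ennreal (gamma_density b (x * u)) =
         ennreal (C * (u powr (b - 1) * (1 - u) powr (a - 1))) * indicator {0..1} u"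
      if u: "u \<noteq> 0" "u \<noteq> 1" for u
    proof (cases "0 < u \<and> u < 1")
      case True
      then have pos: "0 < x * (1 - u)" "0 < x * u" using x by auto
      have eq: "x - x * u = x * (1 - u)" by (simp add: algebra_simps)
      have "gamma_density a (x - x * u) * gamma_density b (x * u) = C * (u powr (b - 1) * (1 - u) powr (a - 1))"
      proof -
        have 1: "exp (- (x * (1 - u))) * exp (- (x * u)) = exp (- x)"
          by (simp add: exp_add [symmetric] algebra_simps)
        have 2: "x powr (a - 1) * x powr (b - 1) = x powr (a + b - 2)"
          by (simp add: powr_add [symmetric] algebra_simps)
        have "gamma_density a (x - x * u) * gamma_density b (x * u) =
           (x powr (a - 1) * x powr (b - 1)) * (exp (- (x * (1 - u))) * exp (- (x * u))) / (Gamma a * Gamma b) * (u powr (b - 1) * (1 - u) powr (a - 1))"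
          unfolding eq using pos x True by (simp add: gamma_density_def powr_mult)
        then show ?thesis unfolding 1 2 C_def .
      qed
      then show ?thesis using True assms
        by (subst ennreal_mult[symmetric]) (auto intro: gamma_density_nonneg)
    next
      case False
      \<comment> \<open>Outside the unit interval one density has a negative argument: the second
        for \<open>u < 0\<close>, the first for \<open>u > 1\<close>.\<close>
      then consider "u < 0" | "1 < u" using u by fastforce
      then show ?thesis
      proof cases
        case 1 then show ?thesis using x by (simp add: gamma_density_def mult_less_0_iff zero_less_mult_iff)
      next
        case 2
        then have "x < x * u" using x by simp
        with 2 show ?thesis by (simp add: gamma_density_def)
      qed
    qed
    show "AE u in lborel. ennreal (gamma_density a (x - x * u)) * ennreal (gamma_density b (x * u)) =
         ennreal (C * (u powr (b - 1) * (1 - u) powr (a - 1))) * indicator {0..1} u"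
      using AE_lborel_singleton[of 0] AE_lborel_singleton[of 1] by eventually_elim (rule eq)
  qed
  also have "\<dots> = ennreal (C * Beta b a)"
    using assms C by (intro nn_integral_has_integral_lebesgue' has_integral_mult_right has_integral_Beta_real) auto
  also have "ennreal x * \<dots> = ennreal (x * (C * Beta b a))"
    using x C G assms by (subst ennreal_mult) (auto simp: Bp Gamma_real_pos less_imp_le)
  also have "x * (C * Beta b a) = gamma_density (a + b) x"
  proof -
    have "x * x powr (a + b - 2) = x powr (a + b - 1)"
      using x powr_add[of x 1 "a + b - 2"] by simp
    then show ?thesis using G x unfolding C_def Bp gamma_density_def by (simp add: field_simps)
  qed
  finally show ?thesis .
qed

text \<open>Both sides sum a nonnegative function over all pairs of naturals; the right side groups
  the pairs by diagonals.\<close>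

lemma suminf_cauchy_ennreal:
  fixes h :: "nat \<Rightarrow> nat \<Rightarrow> ennreal"
  shows "(\<Sum>k. \<Sum>l. h k l) = (\<Sum>n. \<Sum>k\<le>n. h k (n - k))"
proof -
  \<comment> \<open>Reindexing by the diagonal \<open>n = k + l\<close> and padding with zeros makes
    the range of the inner sum independent of \<open>k\<close>.\<close>
  have shift: "(\<Sum>l. h k l) = (\<Sum>n. if k \<le> n then h k (n - k) else 0)" for k
  proof -
    have "(\<Sum>n. if k \<le> n then h k (n - k) else 0) = (\<Sum>n. if k \<le> n + k then h k (n + k - k) else 0) + (\<Sum>n<k. if k \<le> n then h k (n - k) else 0)"
      by (rule suminf_offset) simp
    then show ?thesis by simp
  qed
  have "(\<Sum>k. \<Sum>l. h k l) = (\<Sum>k. \<Sum>n. if k \<le> n then h k (n - k) else 0)"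
    by (simp add: shift)
  \<comment> \<open>Exchange of the two sums, as Tonelli for counting measures.\<close>
  also have "\<dots> = (\<Sum>n. \<Sum>k. if k \<le> n then h k (n - k) else 0)"
    using nn_integral_fst_count_space[of "\<lambda>(k, n). if k \<le> n then h k (n - k) else 0"]
      nn_integral_snd_count_space[of "\<lambda>(k, n). if k \<le> n then h k (n - k) else 0"]
    by (simp add: nn_integral_count_space_nat)
  also have "\<dots> = (\<Sum>n. \<Sum>k\<le>n. h k (n - k))"
    by (intro suminf_cong) (subst suminf_finite[where N="{..n}" for n], auto)
  finally show ?thesis .
qed

text \<open>Convolving term by term gives Gamma densities whose shape depends only on
  \<open>i + j\<close>. Grouping by \<open>i + j\<close> leaves a convolution of Poisson weights,
  which is again Poisson by the binomial theorem.\<close>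

lemma nc_gamma_density_convolution:
  assumes "0 < a" "0 < b" "0 \<le> l" "0 \<le> m"
  shows "(\<integral>\<^sup>+y. nc_gamma_density a l (x - y) * nc_gamma_density b m y \<partial>lborel) =
    nc_gamma_density (a + b) (l + m) x"
proof -
  define p where "p l k = exp (- l) * l ^ k / fact k" for l :: real and k :: nat
  have p: "0 \<le> p l k" if "0 \<le> l" for l k using that by (simp add: p_def)
  have "(\<integral>\<^sup>+y. nc_gamma_density a l (x - y) * nc_gamma_density b m y \<partial>lborel) =
    (\<integral>\<^sup>+y. (\<Sum>i. \<Sum>j. (ennreal (p l i) * ennreal (p m j)) *
      (ennreal (gamma_density (a + real i) (x - y)) * ennreal (gamma_density (b + real j) y))) \<partial>lborel)"
    unfolding nc_gamma_density_def p_def[symmetric]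
    by (simp only: ennreal_suminf_multc[symmetric] ennreal_suminf_cmult[symmetric] mult_ac)
  also have "\<dots> = (\<Sum>i. \<Sum>j. (ennreal (p l i) * ennreal (p m j)) *
      (\<integral>\<^sup>+y. (ennreal (gamma_density (a + real i) (x - y)) * ennreal (gamma_density (b + real j) y)) \<partial>lborel))"
    by (simp add: nn_integral_suminf nn_integral_cmult)
  also have "\<dots> = (\<Sum>i. \<Sum>j. ennreal (p l i) * ennreal (p m j) * ennreal (gamma_density (a + b + real (i + j)) x))"
    using assms by (subst gamma_density_convolution) (auto simp: add_ac)
  also have "\<dots> = (\<Sum>n. \<Sum>i\<le>n. ennreal (p l i) * ennreal (p m (n - i)) * ennreal (gamma_density (a + b + real n) x))"
    by (subst suminf_cauchy_ennreal) simp
  also have "\<dots> = (\<Sum>n. ennreal (p (l + m) n) * ennreal (gamma_density (a + b + real n) x))"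
  proof (intro suminf_cong)
    fix n
    have "(\<Sum>i\<le>n. ennreal (p l i) * ennreal (p m (n - i))) = ennreal (\<Sum>i\<le>n. p l i * p m (n - i))"
      using assms by (simp add: p ennreal_mult[symmetric] sum_ennreal)
    also have "(\<Sum>i\<le>n. p l i * p m (n - i)) = p (l + m) n"
      unfolding p_def binomial_ring sum_distrib_left sum_divide_distrib
      by (intro sum.cong) (auto simp: binomial_fact exp_add[symmetric] mult_exp_exp field_simps)
    finally show "(\<Sum>i\<le>n. ennreal (p l i) * ennreal (p m (n - i)) * ennreal (gamma_density (a + b + real n) x)) =
      ennreal (p (l + m) n) * ennreal (gamma_density (a + b + real n) x)"
      by (simp add: sum_distrib_right[symmetric])
  qed
  finally show ?thesis by (simp add: nc_gamma_density_def p_def)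
qed


section \<open>Squares of shifted normal variables\<close>

text \<open>Substitution on bounded intervals, extended to the half-line by monotone convergence. It
  is used with \<open>c = 1\<close> for squared normals and with \<open>c = 1 / 2\<close> for the
  Marcum integrand.\<close>

lemma nn_integral_square_substitution:
  fixes f :: "real \<Rightarrow> ennreal" and c :: real
  assumes [measurable]: "f \<in> borel_measurable borel" and c: "0 < c"
  shows "(\<integral>\<^sup>+s\<in>{0..}. f s \<partial>lborel) = (\<integral>\<^sup>+x\<in>{0..}. f (c * x\<^sup>2) * ennreal (2 * c * x) \<partial>lborel)"
proof -
  have der: "((\<lambda>x. c * x\<^sup>2) has_real_derivative 2 * c * x) (at x)" for x
    by (auto intro!: derivative_eq_intros)
  \<comment> \<open>The endpoint \<open>real (Suc n)\<close> keeps the interval nondegenerate also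
    at \<open>n = 0\<close>.\<close>
  have bounded: "(\<integral>\<^sup>+x. f x * indicator {0..c * (real (Suc n))\<^sup>2} x \<partial>lborel) =
      (\<integral>\<^sup>+x. f (c * x\<^sup>2) * ennreal (2 * c * x) * indicator {0..real (Suc n)} x \<partial>lborel)" for n
    using nn_integral_substitution_aux[of f 0 "real (Suc n)" "\<lambda>x. c * x\<^sup>2" "\<lambda>x. 2 * c * x"] c
    by (simp add: continuous_intros der)
  have 1: "(\<lambda>n. \<integral>\<^sup>+x. f x * indicator {0..c * (real (Suc n))\<^sup>2} x \<partial>lborel)
     \<longlonglongrightarrow> (\<integral>\<^sup>+s\<in>{0..}. f s \<partial>lborel)"
  proof (rule nn_integral_LIMSEQ)
    show "incseq (\<lambda>n x. f x * indicator {0..c * (real (Suc n))\<^sup>2} x)"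
    proof (rule incseq_SucI, rule le_funI)
      fix n x
      have "c * (real (Suc n))\<^sup>2 \<le> c * (real (Suc (Suc n)))\<^sup>2"
        using c by (intro mult_left_mono power_mono) auto
      then show "f x * indicator {0..c * (real (Suc n))\<^sup>2} x \<le> f x * indicator {0..c * (real (Suc (Suc n)))\<^sup>2} x"
        by (intro mult_left_mono) (auto split: split_indicator)
    qed
    fix x
    have "\<forall>\<^sub>F n in sequentially. x \<le> c * (real (Suc n))\<^sup>2"
      using c by real_asymp
    then have "\<forall>\<^sub>F n in sequentially. f x * indicator {0..c * (real (Suc n))\<^sup>2} x = f x * indicator {0..} x"
      by eventually_elim (auto split: split_indicator)
    then show "(\<lambda>n. f x * indicator {0..c * (real (Suc n))\<^sup>2} x) \<longlonglongrightarrow> f x * indicator {0..} x"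
      by (rule tendsto_eventually)
  qed auto
  have 2: "(\<lambda>n. \<integral>\<^sup>+x. f (c * x\<^sup>2) * ennreal (2 * c * x) * indicator {0..real (Suc n)} x \<partial>lborel)
     \<longlonglongrightarrow> (\<integral>\<^sup>+x\<in>{0..}. f (c * x\<^sup>2) * ennreal (2 * c * x) \<partial>lborel)"
  proof (rule nn_integral_LIMSEQ)
    show "incseq (\<lambda>n x. f (c * x\<^sup>2) * ennreal (2 * c * x) * indicator {0..real (Suc n)} x)"
      by (intro incseq_SucI le_funI mult_left_mono) (auto split: split_indicator)
    fix x
    have "\<forall>\<^sub>F n in sequentially. x \<le> real (Suc n)"
      by real_asymp
    then have "\<forall>\<^sub>F n in sequentially. f (c * x\<^sup>2) * ennreal (2 * c * x) * indicator {0..real (Suc n)} x =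
        f (c * x\<^sup>2) * ennreal (2 * c * x) * indicator {0..} x"
      by eventually_elim (auto split: split_indicator)
    then show "(\<lambda>n. f (c * x\<^sup>2) * ennreal (2 * c * x) * indicator {0..real (Suc n)} x) \<longlonglongrightarrow>
        f (c * x\<^sup>2) * ennreal (2 * c * x) * indicator {0..} x"
      by (rule tendsto_eventually)
  qed auto
  show ?thesis
    using LIMSEQ_unique[OF 1[unfolded bounded] 2] by simp
qed

text \<open>These values bring \<open>fact (2 * k)\<close> into the mixture of shape 1/2, which
  thereby becomes a cosh series.\<close>

lemma Gamma_nat_plus_half:
  "Gamma (1 / 2 + real k) = fact (2 * k) / (4 ^ k * fact k) * sqrt pi"
proof (induction k)
  case 0 then show ?case by (simp add: Gamma_one_half_real)
next
  case (Suc k)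
  have "Gamma (1 / 2 + real (Suc k)) = (1 / 2 + real k) * Gamma (1 / 2 + real k)"
    using Gamma_plus1[of "1 / 2 + real k"] nonpos_Ints_nonpos[of "1 / 2 + real k"]
    by (auto simp: algebra_simps)
  also have "\<dots> = fact (2 * Suc k) / (4 ^ Suc k * fact (Suc k)) * sqrt pi"
    unfolding Suc by (simp add: divide_simps) (simp add: algebra_simps)
  finally show ?case .
qed

lemma sums_cosh_even: "(\<lambda>k. x ^ (2 * k) / fact (2 * k)) sums cosh (x :: real)"
proof -
  have "(\<lambda>n. if even n then x ^ n / fact n else 0) sums cosh x"
    using cosh_converges[of x] by (simp add: divide_inverse_commute if_distrib cong: if_cong)
  then show ?thesis
    by (subst (asm) sums_mono_reindex[of "(*) 2", symmetric])
      (auto simp: strict_mono_def elim: evenE)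
qed

lemma nc_gamma_density_nonpos: "s \<le> 0 \<Longrightarrow> nc_gamma_density a l s = 0"
  by (simp add: nc_gamma_density_def gamma_density_def)

lemma measurable_nc_gamma_density_snd [measurable]: "nc_gamma_density a l \<in> borel_measurable borel"
  using measurable_Pair2[OF measurable_nc_gamma_density, of l] by simp

lemma ennreal_mult3:
  "0 \<le> x \<Longrightarrow> 0 \<le> y \<Longrightarrow> 0 \<le> z \<Longrightarrow> ennreal x * ennreal y * ennreal z = ennreal (x * y * z)"
  by (simp add: ennreal_mult)

text \<open>Both \<open>w\<close> and \<open>- w\<close> have the square \<open>w\<^sup>2\<close>,
  and \<open>2 * w\<close> is the Jacobian of squaring. The mixture sums to a multiple of
  \<open>cosh (2 * u * w)\<close>, whose two exponentials complete the squares of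
  \<open>w - u\<close> and \<open>w + u\<close>.\<close>

lemma nc_gamma_density_half_square:
  assumes w: "0 < w"
  shows "nc_gamma_density (1 / 2) (u\<^sup>2) (w\<^sup>2) * ennreal (2 * w) =
    ennreal (normal_density 0 (sqrt (1 / 2)) (w - u)) + ennreal (normal_density 0 (sqrt (1 / 2)) (- w - u))"
proof -
  let ?c = "2 * exp (- u\<^sup>2 - w\<^sup>2) / sqrt pi"
  \<comment> \<open>The powers of 4 from the Gamma values are absorbed into
    \<open>(2 * u * w) ^ (2 * k)\<close>, so that each term is a constant times an even term of the
    cosh series.\<close>
  have summand: "exp (- u\<^sup>2) * (u\<^sup>2) ^ k / fact k * gamma_density (1 / 2 + real k) (w\<^sup>2) * (2 * w) =
      ?c * ((2 * u * w) ^ (2 * k) / fact (2 * k))" for k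
  proof -
    have "(w\<^sup>2) powr (1 / 2 + real k - 1) = w powr (2 * (1 / 2 + real k - 1))"
      using w by (simp only: powr_powr flip: powr_numeral[OF less_imp_le[OF w]])
    also have "2 * (1 / 2 + real k - 1) = real (2 * k) - 1" by simp
    also have "w powr (real (2 * k) - 1) = w ^ (2 * k) / w"
      using w by (simp only: powr_diff powr_realpow powr_one)
    finally have p: "(w\<^sup>2) powr (1 / 2 + real k - 1) = w ^ (2 * k) / w" .
    have e: "exp (- u\<^sup>2 - w\<^sup>2) = exp (- u\<^sup>2) * exp (- w\<^sup>2)"
      by (simp add: exp_add[symmetric])
    have f: "(2 * u * w) ^ (2 * k) = 4 ^ k * (u\<^sup>2) ^ k * w ^ (2 * k)"
      by (simp add: power_mult_distrib power_mult)
    show ?thesis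
      unfolding gamma_density_def p Gamma_nat_plus_half e f using w by (simp add: field_simps)
  qed
  have "nc_gamma_density (1 / 2) (u\<^sup>2) (w\<^sup>2) * ennreal (2 * w) =
      (\<Sum>k. ennreal (?c * ((2 * u * w) ^ (2 * k) / fact (2 * k))))"
    unfolding nc_gamma_density_def ennreal_suminf_multc[symmetric] summand[symmetric] using w
    by (intro suminf_cong ennreal_mult3) (auto intro!: gamma_density_nonneg)
  also have "\<dots> = ennreal (?c * cosh (2 * u * w))"
    by (intro suminf_ennreal_eq sums_mult sums_cosh_even) (auto simp: power_mult)
  also have "?c * cosh (2 * u * w) = (exp (- (w - u)\<^sup>2) + exp (- (- w - u)\<^sup>2)) / sqrt pi"
  proof -
    have "exp (- (w - u)\<^sup>2) = exp (- u\<^sup>2 - w\<^sup>2) * exp (2 * u * w)"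
      "exp (- (- w - u)\<^sup>2) = exp (- u\<^sup>2 - w\<^sup>2) * exp (- (2 * u * w))"
      by (simp_all add: exp_add[symmetric] power2_eq_square algebra_simps)
    then show ?thesis by (simp add: cosh_field_def add_divide_distrib distrib_left mult_ac)
  qed
  \<comment> \<open>Variance 1/2 makes the normal density
    \<open>exp (- z\<^sup>2) / sqrt pi\<close>.\<close>
  also have "\<dots> = normal_density 0 (sqrt (1 / 2)) (w - u) + normal_density 0 (sqrt (1 / 2)) (- w - u)"
    by (simp add: normal_density_def add_divide_distrib)
  finally show ?thesis by simp
qed

text \<open>The probability of a Borel set is an integral over the line in \<open>w\<close>, the
  shifted variable. Reflecting its negative half onto the positive one and substituting
  \<open>s = w\<^sup>2\<close> exhibits the density.\<close>

lemma (in prob_space) distributed_shifted_normal_square: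
  assumes X: "distributed M lborel X (normal_density 0 (sqrt (1 / 2)))"
  shows "distributed M lborel (\<lambda>\<omega>. (X \<omega> + u)\<^sup>2) (nc_gamma_density (1 / 2) (u\<^sup>2))"
  unfolding distributed_def
proof (intro conjI)
  let ?n = "normal_density 0 (sqrt (1 / 2))"
  have [measurable]: "X \<in> borel_measurable M"
    using distributed_measurable[OF X] by simp
  show "(\<lambda>\<omega>. (X \<omega> + u)\<^sup>2) \<in> measurable M lborel" by simp
  show "distr M lborel (\<lambda>\<omega>. (X \<omega> + u)\<^sup>2) = density lborel (nc_gamma_density (1 / 2) (u\<^sup>2))"
  proof (rule measure_eqI)
    fix A assume "A \<in> sets (distr M lborel (\<lambda>\<omega>. (X \<omega> + u)\<^sup>2))"
    then have [measurable]: "A \<in> sets borel" by simp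
    have "emeasure (distr M lborel (\<lambda>\<omega>. (X \<omega> + u)\<^sup>2)) A = (\<integral>\<^sup>+\<omega>. indicator A ((X \<omega> + u)\<^sup>2) \<partial>M)"
      by (subst nn_integral_indicator[symmetric], simp, subst nn_integral_distr) auto
    also have "\<dots> = (\<integral>\<^sup>+z. ennreal (?n z) * indicator A ((z + u)\<^sup>2) \<partial>lborel)"
      by (rule distributed_nn_integral[OF X, symmetric]) simp
    also have "\<dots> = (\<integral>\<^sup>+w. ennreal (?n (w - u)) * indicator A (w\<^sup>2) \<partial>lborel)"
      by (subst nn_integral_real_affine[where c=1 and t="-u"]) auto
    also have "\<dots> = (\<integral>\<^sup>+w. ennreal (?n (w - u)) * indicator A (w\<^sup>2) * indicator {0..} w
         + ennreal (?n (w - u)) * indicator A (w\<^sup>2) * indicator {..<0} w \<partial>lborel)"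
      by (intro nn_integral_cong) (auto split: split_indicator)
    also have "\<dots> = (\<integral>\<^sup>+w. ennreal (?n (w - u)) * indicator A (w\<^sup>2) * indicator {0..} w \<partial>lborel)
         + (\<integral>\<^sup>+w. ennreal (?n (w - u)) * indicator A (w\<^sup>2) * indicator {..<0} w \<partial>lborel)"
      by (rule nn_integral_add) auto
    \<comment> \<open>The reflection \<open>w\<close> to \<open>- w\<close>; the square in the
      indicator is unaffected.\<close>
    also have "(\<integral>\<^sup>+w. ennreal (?n (w - u)) * indicator A (w\<^sup>2) * indicator {..<0} w \<partial>lborel) =
       (\<integral>\<^sup>+w. ennreal (?n (- w - u)) * indicator A (w\<^sup>2) * indicator {..<0} (- w) \<partial>lborel)"
      by (subst nn_integral_real_affine[where c="-1" and t=0]) auto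
    also have "(\<integral>\<^sup>+w. ennreal (?n (w - u)) * indicator A (w\<^sup>2) * indicator {0..} w \<partial>lborel) + \<dots> =
      (\<integral>\<^sup>+w. ennreal (?n (w - u)) * indicator A (w\<^sup>2) * indicator {0..} w +
         ennreal (?n (- w - u)) * indicator A (w\<^sup>2) * indicator {..<0} (- w) \<partial>lborel)"
      by (rule nn_integral_add[symmetric]) auto
    also have "\<dots> = (\<integral>\<^sup>+w\<in>{0..}. nc_gamma_density (1 / 2) (u\<^sup>2) (1 * w\<^sup>2) * indicator A (1 * w\<^sup>2) * ennreal (2 * 1 * w) \<partial>lborel)"
    proof (rule nn_integral_cong_AE)
      \<comment> \<open>At \<open>w = 0\<close> the two sides can differ, since the mixture density
        is set to 0 there. The factors \<open>1\<close> match the substitution rule at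
        \<open>c = 1\<close>.\<close>
      have eq: "ennreal (?n (w - u)) * indicator A (w\<^sup>2) * indicator {0..} w +
         ennreal (?n (- w - u)) * indicator A (w\<^sup>2) * indicator {..<0} (- w) =
         nc_gamma_density (1 / 2) (u\<^sup>2) (1 * w\<^sup>2) * indicator A (1 * w\<^sup>2) * ennreal (2 * 1 * w) * indicator {0..} w"
        if "w \<noteq> 0" for w :: real
      proof (cases "0 < w")
        case True
        then show ?thesis using nc_gamma_density_half_square[OF True, of u]
          by (simp split: split_indicator)
      qed (use that in \<open>auto split: split_indicator\<close>)
      show "AE w in lborel. ennreal (?n (w - u)) * indicator A (w\<^sup>2) * indicator {0..} w +
         ennreal (?n (- w - u)) * indicator A (w\<^sup>2) * indicator {..<0} (- w) =
         nc_gamma_density (1 / 2) (u\<^sup>2) (1 * w\<^sup>2) * indicator A (1 * w\<^sup>2) * ennreal (2 * 1 * w) * indicator {0..} w"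
        using AE_lborel_singleton[of 0] by eventually_elim (rule eq)
    qed
    also have "\<dots> = (\<integral>\<^sup>+s\<in>{0..}. nc_gamma_density (1 / 2) (u\<^sup>2) s * indicator A s \<partial>lborel)"
      by (rule nn_integral_square_substitution[symmetric]) auto
    also have "\<dots> = (\<integral>\<^sup>+s. nc_gamma_density (1 / 2) (u\<^sup>2) s * indicator A s \<partial>lborel)"
      by (intro nn_integral_cong) (auto simp: nc_gamma_density_nonpos split: split_indicator)
    also have "\<dots> = emeasure (density lborel (nc_gamma_density (1 / 2) (u\<^sup>2))) A"
      by (simp add: emeasure_density)
    finally show "emeasure (distr M lborel (\<lambda>\<omega>. (X \<omega> + u)\<^sup>2)) A = \<dots>" .
  qed simp
qed simp

text \<open>Each summand contributes shape 1/2 and its own rate, and independence turns the sum into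
  a convolution. The induction starts at a singleton because the empty sum is constant and has no
  density.\<close>

lemma (in prob_space) distributed_sum_shifted_normal_square:
  assumes K: "finite K" "K \<noteq> {}"
    and ind: "indep_vars (\<lambda>_. borel) W K"
    and W: "\<And>i. i \<in> K \<Longrightarrow> distributed M lborel (W i) (normal_density 0 (sqrt (1 / 2)))"
  shows "distributed M lborel (\<lambda>\<omega>. \<Sum>i\<in>K. (W i \<omega> + u i)\<^sup>2)
    (nc_gamma_density (real (card K) / 2) (\<Sum>i\<in>K. (u i)\<^sup>2))"
  using assms
proof (induction rule: finite_ne_induct)
  case (singleton i)
  then show ?case using distributed_shifted_normal_square[of "W i" "u i"] by simp
next
  case (insert i K)
  have "indep_vars (\<lambda>_. borel) (\<lambda>j \<omega>. (W j \<omega> + u j)\<^sup>2) (insert i K)"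
    by (rule indep_vars_compose2[OF insert.prems(1)]) simp
  then have "indep_var borel (\<lambda>\<omega>. (W i \<omega> + u i)\<^sup>2) borel (\<lambda>\<omega>. \<Sum>j\<in>K. (W j \<omega> + u j)\<^sup>2)"
    using insert.hyps by (intro indep_vars_sum)
  moreover have "distributed M lborel (\<lambda>\<omega>. \<Sum>j\<in>K. (W j \<omega> + u j)\<^sup>2)
      (nc_gamma_density (real (card K) / 2) (\<Sum>j\<in>K. (u j)\<^sup>2))"
    using insert.prems by (intro insert.IH indep_vars_subset[OF insert.prems(1)]) auto
  moreover have "distributed M lborel (\<lambda>\<omega>. (W i \<omega> + u i)\<^sup>2) (nc_gamma_density (1 / 2) ((u i)\<^sup>2))"
    using insert.prems by (intro distributed_shifted_normal_square) auto
  ultimately have "distributed M lborel (\<lambda>\<omega>. (W i \<omega> + u i)\<^sup>2 + (\<Sum>j\<in>K. (W j \<omega> + u j)\<^sup>2))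
     (\<lambda>x. \<integral>\<^sup>+y. nc_gamma_density (1 / 2) ((u i)\<^sup>2) (x - y) *
        nc_gamma_density (real (card K) / 2) (\<Sum>j\<in>K. (u j)\<^sup>2) y \<partial>lborel)"
    by (intro distributed_convolution)
  also have "(\<lambda>x. \<integral>\<^sup>+y. nc_gamma_density (1 / 2) ((u i)\<^sup>2) (x - y) *
        nc_gamma_density (real (card K) / 2) (\<Sum>j\<in>K. (u j)\<^sup>2) y \<partial>lborel) =
      nc_gamma_density (1 / 2 + real (card K) / 2) ((u i)\<^sup>2 + (\<Sum>j\<in>K. (u j)\<^sup>2))"
    using insert.hyps by (intro ext nc_gamma_density_convolution) (auto simp: card_gt_0_iff sum_nonneg)
  finally show ?case using insert.hyps by (simp add: add_divide_distrib)
qed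


section \<open>The Marcum function as a tail of the mixture\<close>

lemma nn_integral_nc_gamma_density:
  assumes "0 < a" "0 \<le> l"
  shows "(\<integral>\<^sup>+s. nc_gamma_density a l s \<partial>lborel) = 1"
proof -
  have "(\<lambda>k. exp (- l) * l ^ k / fact k) sums (exp (- l) * exp l)"
    using sums_mult[OF exp_converges[of l], of "exp (- l)"] by (simp add: divide_inverse_commute mult_ac)
  then have "(\<Sum>k. ennreal (exp (- l) * l ^ k / fact k)) = ennreal (exp (- l) * exp l)"
    using assms by (intro suminf_ennreal_eq) auto
  then show ?thesis
    using assms by (simp add: nc_gamma_density_def nn_integral_suminf nn_integral_cmult
        nn_integral_gamma_density exp_minus)
qed

lemma gamma_density_Suc:
  assumes "0 < s"
  shows "gamma_density (1 + real n) s = s ^ n * exp (- s) / fact n"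
  using assms by (simp add: gamma_density_def Gamma_fact powr_realpow)

lemma nc_gamma_density_0: "0 < a \<Longrightarrow> nc_gamma_density a 0 s = ennreal (gamma_density a s)"
  unfolding nc_gamma_density_def by (subst suminf_finite[where N="{0}"]) auto

text \<open>Since \<open>fact (k + n)\<close> is at least 1, the series is dominated by a multiple
  of the exponential series at \<open>(z / 2)\<^sup>2\<close>. Convergence ensures that
  \<open>bessel_I\<close> is the actual limit of the partial sums.\<close>

lemma sums_bessel_I: "(\<lambda>k. (z / 2) ^ (2 * k + n) / (fact k * fact (k + n))) sums bessel_I n z"
proof -
  have "summable (\<lambda>k. (z / 2) ^ (2 * k + n) / (fact k * fact (k + n)))"
  proof (rule summable_comparison_test')
    show "summable (\<lambda>k. \<bar>z / 2\<bar> ^ n * (((z / 2)\<^sup>2) ^ k / fact k))"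
      using summable_exp[of "(z / 2)\<^sup>2"] by (intro summable_mult) (simp only: divide_inverse_commute)
    fix k
    have fact: "fact k * 1 \<le> fact k * (fact (k + n) :: real)"
      by (intro mult_left_mono) auto
    have "norm ((z / 2) ^ (2 * k + n) / (fact k * fact (k + n))) =
        \<bar>z / 2\<bar> ^ (2 * k + n) / (fact k * fact (k + n))"
      by (simp only: real_norm_def abs_divide abs_mult power_abs abs_of_nonneg[OF fact_ge_zero])
    also have "\<bar>z / 2\<bar> ^ (2 * k + n) = \<bar>z / 2\<bar> ^ n * ((z / 2)\<^sup>2) ^ k"
      unfolding power_add power_mult power2_abs by (rule mult.commute)
    also have "\<dots> / (fact k * fact (k + n)) \<le> \<bar>z / 2\<bar> ^ n * ((z / 2)\<^sup>2) ^ k / (fact k * 1)"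
      using fact by (intro divide_left_mono) auto
    finally show "norm ((z / 2) ^ (2 * k + n) / (fact k * fact (k + n))) \<le> \<bar>z / 2\<bar> ^ n * (((z / 2)\<^sup>2) ^ k / fact k)"
      by simp
  qed
  then show ?thesis by (simp add: bessel_I_def sums_iff)
qed

lemma bessel_I_nonneg: "0 \<le> z \<Longrightarrow> 0 \<le> bessel_I n z"
  by (rule sums_le[OF _ sums_zero sums_bessel_I]) auto

lemma measurable_bessel_I [measurable]: "bessel_I n \<in> borel_measurable borel"
  unfolding bessel_I_def by measurable

text \<open>The \<open>k\<close>-th Bessel term, with its prefactors, is the \<open>k\<close>-th
  Poisson term at \<open>s = x\<^sup>2 / 2\<close>; the factor \<open>ennreal x\<close> is the
  Jacobian.\<close>

lemma marcum_integrand_eq: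
  assumes "0 < a" "0 < x"
  shows "ennreal (x * (x / a) ^ n * exp (- (x\<^sup>2 + a\<^sup>2) / 2) * bessel_I n (a * x)) =
    nc_gamma_density (1 + real n) (a\<^sup>2 / 2) (x\<^sup>2 / 2) * ennreal x"
proof -
  have summand: "exp (- (a\<^sup>2 / 2)) * (a\<^sup>2 / 2) ^ k / fact k * gamma_density (1 + real n + real k) (x\<^sup>2 / 2) * x =
     x * (x / a) ^ n * exp (- (x\<^sup>2 + a\<^sup>2) / 2) * ((a * x / 2) ^ (2 * k + n) / (fact k * fact (k + n)))" for k
  proof -
    have e: "exp (- (x\<^sup>2 + a\<^sup>2) / 2) = exp (- (x\<^sup>2 / 2)) * exp (- (a\<^sup>2 / 2))"
      by (simp add: exp_add[symmetric] field_simps)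
    have g: "gamma_density (1 + real n + real k) (x\<^sup>2 / 2) = (x\<^sup>2 / 2) ^ (n + k) * exp (- (x\<^sup>2 / 2)) / fact (n + k)"
      using gamma_density_Suc[of "x\<^sup>2 / 2" "n + k"] assms by (simp add: add_ac)
    \<comment> \<open>Each of the \<open>n\<close> factors \<open>x / a\<close> pairs with one
      \<open>a * x / 2\<close> to give \<open>x\<^sup>2 / 2\<close>; the other \<open>2 * k\<close>
      factors pair among themselves.\<close>
    have "(a\<^sup>2 / 2) ^ k * (x\<^sup>2 / 2) ^ (n + k) = (x / a) ^ n * (a * x / 2) ^ (2 * k + n)"
    proof -
      have "(x / a) ^ n * (a * x / 2) ^ (2 * k + n) = ((x / a) * (a * x / 2)) ^ n * ((a * x / 2)\<^sup>2) ^ k"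
        by (simp only: power_add power_mult) (simp only: power_mult_distrib mult_ac)
      also have "(x / a) * (a * x / 2) = x\<^sup>2 / 2"
        using assms by (simp add: power2_eq_square)
      also have "(a * x / 2)\<^sup>2 = (a\<^sup>2 / 2) * (x\<^sup>2 / 2)" by (simp add: power2_eq_square)
      finally show ?thesis by (simp only: power_add power_mult_distrib mult_ac)
    qed
    note powers = this
    have "exp (- (a\<^sup>2 / 2)) * (a\<^sup>2 / 2) ^ k / fact k * ((x\<^sup>2 / 2) ^ (n + k) * exp (- (x\<^sup>2 / 2)) / fact (n + k)) * x =
      ((a\<^sup>2 / 2) ^ k * (x\<^sup>2 / 2) ^ (n + k)) * (exp (- (x\<^sup>2 / 2)) * exp (- (a\<^sup>2 / 2)) * x / (fact k * fact (k + n)))"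
      by (simp only: times_divide_eq_left times_divide_eq_right divide_divide_eq_left mult_ac add_ac)
    then show ?thesis unfolding e g powers
      by (simp only: times_divide_eq_left times_divide_eq_right divide_divide_eq_left mult_ac add_ac)
  qed
  have "nc_gamma_density (1 + real n) (a\<^sup>2 / 2) (x\<^sup>2 / 2) * ennreal x =
      (\<Sum>k. ennreal (x * (x / a) ^ n * exp (- (x\<^sup>2 + a\<^sup>2) / 2) * ((a * x / 2) ^ (2 * k + n) / (fact k * fact (k + n)))))"
    unfolding nc_gamma_density_def ennreal_suminf_multc[symmetric] summand[symmetric] using assms
    by (intro suminf_cong ennreal_mult3) (auto intro!: gamma_density_nonneg)
  also have "\<dots> = ennreal (x * (x / a) ^ n * exp (- (x\<^sup>2 + a\<^sup>2) / 2) * bessel_I n (a * x))"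
    using assms by (intro suminf_ennreal_eq sums_mult sums_bessel_I) auto
  finally show ?thesis ..
qed

text \<open>Square-root arguments make \<open>l\<close> the Poisson rate and \<open>r\<close> the
  threshold after \<open>s = x\<^sup>2 / 2\<close>. At \<open>l = 0\<close>, where
  \<open>marcum_Q\<close> has its own clause, only the Poisson term with \<open>k = 0\<close>
  survives.\<close>

lemma marcum_Q_eq_tail:
  assumes "0 \<le> l" "0 \<le> r"
  shows "marcum_Q (Suc n) (sqrt (2 * l)) (sqrt (2 * r)) =
    enn2real (\<integral>\<^sup>+s\<in>{r..}. nc_gamma_density (1 + real n) l s \<partial>lborel)"
proof (cases "l = 0")
  case True
  have "marcum_Q (Suc n) (sqrt (2 * l)) (sqrt (2 * r)) = (LBINT s:{r..}. 1 / fact n * (s ^ n * exp (- s)))"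
    using True assms by (simp add: marcum_Q_def)
  also have "\<dots> = enn2real (\<integral>\<^sup>+s. ennreal (indicator {r..} s * (1 / fact n * (s ^ n * exp (- s)))) \<partial>lborel)"
    unfolding set_lebesgue_integral_def real_scaleR_def using assms
    by (intro integral_eq_nn_integral) (auto split: split_indicator)
  also have "(\<integral>\<^sup>+s. ennreal (indicator {r..} s * (1 / fact n * (s ^ n * exp (- s)))) \<partial>lborel) =
     (\<integral>\<^sup>+s\<in>{r..}. nc_gamma_density (1 + real n) l s \<partial>lborel)"
  proof (rule nn_integral_cong_AE)
    \<comment> \<open>For \<open>n = 0\<close> and \<open>r = 0\<close> the sides differ at
      \<open>s = 0\<close>, where the Gamma density is set to 0.\<close>
    have eq: "ennreal (indicator {r..} s * (1 / fact n * (s ^ n * exp (- s)))) =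
        nc_gamma_density (1 + real n) l s * indicator {r..} s" if "s \<noteq> 0" for s :: real
      using True that assms
      by (cases "0 < s") (auto simp: nc_gamma_density_0 gamma_density_Suc split: split_indicator)
    show "AE s in lborel. ennreal (indicator {r..} s * (1 / fact n * (s ^ n * exp (- s)))) =
        nc_gamma_density (1 + real n) l s * indicator {r..} s"
      using AE_lborel_singleton[of 0] by eventually_elim (rule eq)
  qed
  finally show ?thesis .
next
  case False
  define a b where "a = sqrt (2 * l)" and "b = sqrt (2 * r)"
  have a: "0 < a" "a\<^sup>2 / 2 = l" and b: "0 \<le> b" using assms False by (auto simp: a_def b_def)
  \<comment> \<open>Translates the lower limit \<open>b\<close> of the Marcum integral into the
    threshold \<open>r\<close> for \<open>s\<close>.\<close>
  have r: "r \<le> 1 / 2 * x\<^sup>2 \<longleftrightarrow> b \<le> x" if "0 < x" for x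
    using that real_sqrt_le_iff[of "2 * r" "x\<^sup>2"] by (simp add: b_def field_simps)
  have "marcum_Q (Suc n) a b = (LBINT x:{b..}. x * (x / a) ^ n * exp (- (x\<^sup>2 + a\<^sup>2) / 2) * bessel_I n (a * x))"
    using a by (simp add: marcum_Q_def)
  also have "\<dots> = enn2real (\<integral>\<^sup>+x. ennreal (indicator {b..} x * (x * (x / a) ^ n * exp (- (x\<^sup>2 + a\<^sup>2) / 2) * bessel_I n (a * x))) \<partial>lborel)"
    unfolding set_lebesgue_integral_def real_scaleR_def using a b
    by (intro integral_eq_nn_integral) (auto intro!: AE_I2 mult_nonneg_nonneg bessel_I_nonneg simp: indicator_def)
  also have "(\<integral>\<^sup>+x. ennreal (indicator {b..} x * (x * (x / a) ^ n * exp (- (x\<^sup>2 + a\<^sup>2) / 2) * bessel_I n (a * x))) \<partial>lborel) =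
     (\<integral>\<^sup>+x\<in>{0..}. nc_gamma_density (1 + real n) l (1 / 2 * x\<^sup>2) * indicator {r..} (1 / 2 * x\<^sup>2) * ennreal (2 * (1 / 2) * x) \<partial>lborel)"
  proof (rule nn_integral_cong_AE)
    have eq: "ennreal (indicator {b..} x * (x * (x / a) ^ n * exp (- (x\<^sup>2 + a\<^sup>2) / 2) * bessel_I n (a * x))) =
        nc_gamma_density (1 + real n) l (1 / 2 * x\<^sup>2) * indicator {r..} (1 / 2 * x\<^sup>2) * ennreal (2 * (1 / 2) * x) * indicator {0..} x"
      if "x \<noteq> 0" for x
    proof (cases "0 < x")
      case True
      then show ?thesis
        using marcum_integrand_eq[OF a(1) True, of n] r[OF True] unfolding a(2)
        by (simp split: split_indicator)
    qed (use that b in \<open>auto split: split_indicator\<close>)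
    show "AE x in lborel. ennreal (indicator {b..} x * (x * (x / a) ^ n * exp (- (x\<^sup>2 + a\<^sup>2) / 2) * bessel_I n (a * x))) =
        nc_gamma_density (1 + real n) l (1 / 2 * x\<^sup>2) * indicator {r..} (1 / 2 * x\<^sup>2) * ennreal (2 * (1 / 2) * x) * indicator {0..} x"
      using AE_lborel_singleton[of 0] by eventually_elim (rule eq)
  qed
  also have "\<dots> = (\<integral>\<^sup>+s\<in>{0..}. nc_gamma_density (1 + real n) l s * indicator {r..} s \<partial>lborel)"
    by (rule nn_integral_square_substitution[symmetric]) auto
  also have "\<dots> = (\<integral>\<^sup>+s\<in>{r..}. nc_gamma_density (1 + real n) l s \<partial>lborel)"
    using assms by (intro nn_integral_cong) (auto split: split_indicator)
  finally show ?thesis unfolding a_def b_def .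
qed

text \<open>The mixture has total mass 1, so the complement of the tail is the mass below
  \<open>r\<close>. The bound by 1 is kept separately because \<open>ennreal\<close> would truncate
  a negative difference to 0.\<close>

lemma ennreal_one_minus_marcum_Q:
  assumes "0 \<le> l" "0 \<le> r"
  shows "ennreal (1 - marcum_Q (Suc n) (sqrt (2 * l)) (sqrt (2 * r))) =
      (\<integral>\<^sup>+s\<in>{..<r}. nc_gamma_density (1 + real n) l s \<partial>lborel)"
    and "marcum_Q (Suc n) (sqrt (2 * l)) (sqrt (2 * r)) \<le> 1"
proof -
  let ?T = "\<integral>\<^sup>+s\<in>{r..}. nc_gamma_density (1 + real n) l s \<partial>lborel"
  let ?C = "\<integral>\<^sup>+s\<in>{..<r}. nc_gamma_density (1 + real n) l s \<partial>lborel"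
  have "?T + ?C = (\<integral>\<^sup>+s. nc_gamma_density (1 + real n) l s \<partial>lborel)"
    by (subst nn_integral_add[symmetric]) (auto intro!: nn_integral_cong split: split_indicator)
  then have 1: "?T + ?C = 1" using assms by (simp add: nn_integral_nc_gamma_density)
  then have top: "?T \<noteq> \<top>" "?C \<noteq> \<top>" by auto
  obtain t where t: "?T = ennreal t" "0 \<le> t" using top(1) by (cases ?T) auto
  obtain c where c: "?C = ennreal c" "0 \<le> c" using top(2) by (cases ?C) auto
  note tc = t c
  with 1 have "t + c = 1" by (simp flip: ennreal_plus)
  then have "1 - t = c" by simp
  then show "ennreal (1 - marcum_Q (Suc n) (sqrt (2 * l)) (sqrt (2 * r))) = ?C"
    and "marcum_Q (Suc n) (sqrt (2 * l)) (sqrt (2 * r)) \<le> 1"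
    unfolding marcum_Q_eq_tail[OF assms] using tc \<open>1 - t = c\<close> by simp_all
qed


section \<open>Conditioning on the reference variables\<close>

text \<open>Fix the variables indexed by \<open>K0\<close>. The blocks \<open>K m\<close> are then
  independent sums of squares with constant shifts, and the bijections \<open>q\<close> give every
  block the same rate, \<open>c\<^sup>2\<close> times the reference sum of squares. Integrating over
  the law of that sum gives the formula.\<close>

lemma (in prob_space) emeasure_shifted_normal_blocks:
  fixes W :: "'i \<Rightarrow> 'a \<Rightarrow> real" and q :: "'i \<Rightarrow> 'i"
  assumes L: "finite L"
    and K0: "finite K0" "K0 \<noteq> {}"
    and K: "disjoint_family_on K L" "\<And>m. m \<in> L \<Longrightarrow> K0 \<inter> K m = {}"
    and q: "\<And>m. m \<in> L \<Longrightarrow> bij_betw q (K m) K0"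
    and ind: "indep_vars (\<lambda>_. borel) W (K0 \<union> (\<Union>m\<in>L. K m))"
    and W: "\<And>i. i \<in> K0 \<union> (\<Union>m\<in>L. K m) \<Longrightarrow>
      distributed M lborel (W i) (normal_density 0 (sqrt (1 / 2)))"
  shows "emeasure M {\<omega> \<in> space M. (\<Sum>i\<in>K0. (W i \<omega>)\<^sup>2) < r0 \<and>
        (\<forall>m\<in>L. (\<Sum>i\<in>K m. (W i \<omega> + c * W (q i) \<omega>)\<^sup>2) < r)} =
    (\<integral>\<^sup>+s. nc_gamma_density (real (card K0) / 2) 0 s *
       (indicator {..<r0} s *
        (\<integral>\<^sup>+t\<in>{..<r}. nc_gamma_density (real (card K0) / 2) (c\<^sup>2 * s) t \<partial>lborel) ^ card L) \<partial>lborel)"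
    (is "emeasure M ?E = _")
proof -
  define F where "F l = (\<integral>\<^sup>+t\<in>{..<r}. nc_gamma_density (real (card K0) / 2) l t \<partial>lborel)" for l
  have [measurable]: "F \<in> borel_measurable borel" unfolding F_def by measurable
  define B where "B = (\<Union>m\<in>L. K m)"
  define S where "S = PiM K0 (\<lambda>_. borel :: real measure)"
  define T where "T = PiM B (\<lambda>_. borel :: real measure)"
  \<comment> \<open>\<open>U\<close> and \<open>V\<close> are the reference variables and all other
    variables as random tuples, independent because their index sets are disjoint.\<close>
  define U where "U \<omega> = restrict (\<lambda>i. W i \<omega>) K0" for \<omega>
  define V where "V \<omega> = restrict (\<lambda>i. W i \<omega>) B" for \<omega>
  define f0 where "f0 u = (\<Sum>i\<in>K0. (u i)\<^sup>2)" for u :: "'i \<Rightarrow> real"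
  define g where "g m u v = (\<Sum>i\<in>K m. (v i + c * u (q i))\<^sup>2)" for m and u v :: "'i \<Rightarrow> real"
  have finK: "finite (K m)" and cardK: "card (K m) = card K0" and qK: "\<And>i. i \<in> K m \<Longrightarrow> q i \<in> K0"
    and KneK: "K m \<noteq> {}" if "m \<in> L" for m
    using q[OF that] K0 bij_betw_finite bij_betw_same_card by (fastforce simp: bij_betw_def)+
  have UV: "indep_var S U T V"
    unfolding S_def T_def U_def V_def using K(2) by (intro indep_var_restrict[OF ind]) (auto simp: B_def)
  have [measurable]: "U \<in> measurable M S" "V \<in> measurable M T"
    using UV by (auto dest: indep_var_rv1 indep_var_rv2)
  have [measurable]: "f0 \<in> borel_measurable S"
    unfolding f0_def S_def by (intro borel_measurable_sum borel_measurable_power measurable_component_singleton)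
  have [measurable]: "(\<lambda>x. g m (fst x) (snd x)) \<in> borel_measurable (S \<Otimes>\<^sub>M T)" if "m \<in> L" for m
  proof -
    have "(\<lambda>x. snd x i + c * fst x (q i)) \<in> borel_measurable (S \<Otimes>\<^sub>M T)" if "i \<in> K m" for i
      using qK[OF \<open>m \<in> L\<close> that] that \<open>m \<in> L\<close> unfolding S_def T_def
      by (intro borel_measurable_add borel_measurable_times borel_measurable_const
          measurable_compose[OF measurable_fst measurable_component_singleton]
          measurable_compose[OF measurable_snd measurable_component_singleton]) (auto simp: B_def)
    then show ?thesis unfolding g_def by (intro borel_measurable_sum borel_measurable_power)
  qed
  \<comment> \<open>The event as a set of pairs of tuples, whose sections at fixed \<open>u\<close>
    are conditional events.\<close>
  define Q where "Q = {x \<in> space (S \<Otimes>\<^sub>M T). f0 (fst x) < r0 \<and> (\<forall>m\<in>L. g m (fst x) (snd x) < r)}"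
  have Q[measurable]: "Q \<in> sets (S \<Otimes>\<^sub>M T)"
    unfolding Q_def using L by measurable
  have UV_space: "U \<omega> \<in> space S" "V \<omega> \<in> space T" if "\<omega> \<in> space M" for \<omega>
    using that by (auto intro: measurable_space)
  have f0_U: "f0 (U \<omega>) = (\<Sum>i\<in>K0. (W i \<omega>)\<^sup>2)" for \<omega>
    by (simp add: f0_def U_def)
  have g_V: "g m u (V \<omega>) = (\<Sum>i\<in>K m. (W i \<omega> + c * u (q i))\<^sup>2)" if "m \<in> L" for m u \<omega>
    using that unfolding g_def V_def B_def by (intro sum.cong) auto
  have g_UV: "g m (U \<omega>) (V \<omega>) = (\<Sum>i\<in>K m. (W i \<omega> + c * W (q i) \<omega>)\<^sup>2)" if "m \<in> L" for m \<omega>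
    unfolding g_V[OF that] U_def using qK[OF that] by (intro sum.cong) auto
  have slice: "emeasure (distr M T V) (Pair u -` Q) = indicator {..<r0} (f0 u) * F (c\<^sup>2 * f0 u) ^ card L"
    if u: "u \<in> space S" for u
  proof -
    \<comment> \<open>With \<open>u\<close> fixed, each sum is a function of its own block of
      variables only.\<close>
    have indep_g: "indep_vars (\<lambda>_. borel) (\<lambda>m \<omega>. g m u (V \<omega>)) L"
    proof -
      have "indep_vars (\<lambda>m. PiM (K m) (\<lambda>_. borel)) (\<lambda>m \<omega>. restrict (\<lambda>i. W i \<omega>) (K m)) L"
        using K by (intro indep_vars_restrict[OF ind]) auto
      then have "indep_vars (\<lambda>_. borel)
          (\<lambda>m \<omega>. \<Sum>i\<in>K m. (restrict (\<lambda>i. W i \<omega>) (K m) i + c * u (q i))\<^sup>2) L"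
        by (rule indep_vars_compose2) (intro borel_measurable_sum borel_measurable_power
            borel_measurable_add borel_measurable_const measurable_component_singleton)
      then show ?thesis
        by (rule indep_vars_cong[THEN iffD1, rotated -1]) (auto simp: g_V)
    qed
    have g_prob: "emeasure M ((\<lambda>\<omega>. g m u (V \<omega>)) -` {..<r} \<inter> space M) = F (c\<^sup>2 * f0 u)" if m: "m \<in> L" for m
    proof -
      have "distributed M lborel (\<lambda>\<omega>. g m u (V \<omega>))
          (nc_gamma_density (real (card (K m)) / 2) (\<Sum>i\<in>K m. (c * u (q i))\<^sup>2))"
        unfolding g_V[OF m] using m finK KneK
        by (intro distributed_sum_shifted_normal_square indep_vars_subset[OF ind] W) auto
      \<comment> \<open>Here the dependence on \<open>u\<close> collapses to
        \<open>f0 u\<close>.\<close>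
      moreover have "(\<Sum>i\<in>K m. (c * u (q i))\<^sup>2) = c\<^sup>2 * f0 u"
        unfolding f0_def power_mult_distrib sum_distrib_left[symmetric]
        using sum.reindex_bij_betw[OF q[OF m], of "\<lambda>i. (u i)\<^sup>2"] by simp
      ultimately show ?thesis
        unfolding F_def using m by (subst distributed_emeasure) (auto simp: cardK)
    qed
    have "emeasure M {\<omega> \<in> space M. \<forall>m\<in>L. g m u (V \<omega>) < r} = F (c\<^sup>2 * f0 u) ^ card L"
    \<comment> \<open>Without further blocks the event is the whole space and the power is 1; the
      product rule for independent events is applied to nonempty \<open>L\<close>.\<close>
    proof (cases "L = {}")
      case False
      have "{\<omega> \<in> space M. \<forall>m\<in>L. g m u (V \<omega>) < r} = (\<Inter>m\<in>L. (\<lambda>\<omega>. g m u (V \<omega>)) -` {..<r} \<inter> space M)"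
        using False by auto
      also have "emeasure M \<dots> = ennreal (\<Prod>m\<in>L. prob ((\<lambda>\<omega>. g m u (V \<omega>)) -` {..<r} \<inter> space M))"
        unfolding emeasure_eq_measure
        by (subst indep_varsD_finite[OF indep_g False L]) auto
      also have "\<dots> = (\<Prod>m\<in>L. F (c\<^sup>2 * f0 u))"
        by (subst prod_ennreal[symmetric]) (auto simp: emeasure_eq_measure[symmetric] g_prob)
      finally show ?thesis by simp
    qed (simp add: emeasure_space_1)
    moreover have "V -` (Pair u -` Q) \<inter> space M =
        (if f0 u < r0 then {\<omega> \<in> space M. \<forall>m\<in>L. g m u (V \<omega>) < r} else {})"
      using u UV_space by (auto simp: Q_def space_pair_measure)
    ultimately show ?thesis
      by (subst emeasure_distr) (auto split: split_indicator)
  qed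
  interpret V: prob_space "distr M T V" by (rule prob_space_distr) simp
  have "?E = (\<lambda>\<omega>. (U \<omega>, V \<omega>)) -` Q \<inter> space M"
    using UV_space by (auto simp: Q_def space_pair_measure f0_U g_UV)
  then have "emeasure M ?E = emeasure (distr M (S \<Otimes>\<^sub>M T) (\<lambda>\<omega>. (U \<omega>, V \<omega>))) Q"
    by (simp add: emeasure_distr)
  \<comment> \<open>Independence makes the joint law a product, so its measure of \<open>Q\<close>
    is the integral of the section measures.\<close>
  also have "distr M (S \<Otimes>\<^sub>M T) (\<lambda>\<omega>. (U \<omega>, V \<omega>)) = distr M S U \<Otimes>\<^sub>M distr M T V"
    using UV by (simp add: indep_var_distribution_eq)
  also have "emeasure (distr M S U \<Otimes>\<^sub>M distr M T V) Q = (\<integral>\<^sup>+u. emeasure (distr M T V) (Pair u -` Q) \<partial>distr M S U)"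
    by (rule V.emeasure_pair_measure_alt) (simp cong: sets_pair_measure_cong)
  also have "\<dots> = (\<integral>\<^sup>+u. indicator {..<r0} (f0 u) * F (c\<^sup>2 * f0 u) ^ card L \<partial>distr M S U)"
    by (intro nn_integral_cong) (simp add: slice)
  also have "\<dots> = (\<integral>\<^sup>+\<omega>. indicator {..<r0} (f0 (U \<omega>)) * F (c\<^sup>2 * f0 (U \<omega>)) ^ card L \<partial>M)"
    by (rule nn_integral_distr) auto
  also have "\<dots> = (\<integral>\<^sup>+s. nc_gamma_density (real (card K0) / 2) 0 s * (indicator {..<r0} s * F (c\<^sup>2 * s) ^ card L) \<partial>lborel)"
  proof -
    \<comment> \<open>The reference sum is the case of zero shifts, hence rate 0.\<close>
    have "distributed M lborel (\<lambda>\<omega>. \<Sum>i\<in>K0. (W i \<omega> + 0)\<^sup>2)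
        (nc_gamma_density (real (card K0) / 2) (\<Sum>i\<in>K0. 0\<^sup>2))"
      using K0 by (intro distributed_sum_shifted_normal_square indep_vars_subset[OF ind] W) auto
    then have "distributed M lborel (\<lambda>\<omega>. f0 (U \<omega>)) (nc_gamma_density (real (card K0) / 2) 0)"
      by (simp add: f0_U)
    then show ?thesis
      by (rule distributed_nn_integral[symmetric]) simp
  qed
  finally show ?thesis unfolding F_def .
qed

section \<open>Port gains and the outage formula\<close>

lemma cmod_fas_channel_1:
  "(cmod (fas_channel \<sigma> \<rho> x y 1 n \<omega>))\<^sup>2 = \<sigma>\<^sup>2 * ((x 0 n \<omega>)\<^sup>2 + (y 0 n \<omega>)\<^sup>2)"
  by (simp add: fas_channel_def cmod_power2 power_mult_distrib distrib_left)

text \<open>Pulling out \<open>sqrt (1 - \<rho>\<^sup>2)\<close>, which is positive, leaves the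
  port's own variables with coefficient 1, so the reference variables act as shifts.\<close>

lemma cmod_fas_channel:
  assumes "m \<noteq> 1" "\<bar>\<rho>\<bar> < 1"
  shows "(cmod (fas_channel \<sigma> \<rho> x y m n \<omega>))\<^sup>2 = \<sigma>\<^sup>2 * (1 - \<rho>\<^sup>2) *
    ((x m n \<omega> + \<rho> / sqrt (1 - \<rho>\<^sup>2) * x 0 n \<omega>)\<^sup>2 + (y m n \<omega> + \<rho> / sqrt (1 - \<rho>\<^sup>2) * y 0 n \<omega>)\<^sup>2)"
proof -
  define d where "d = sqrt (1 - \<rho>\<^sup>2)"
  have "\<rho>\<^sup>2 < 1" using assms by (simp add: abs_square_less_1)
  then have d: "0 < d" "1 - \<rho>\<^sup>2 = d\<^sup>2" by (simp_all add: d_def)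
  have eq: "(\<sigma> * (d * a + \<rho> * b))\<^sup>2 = \<sigma>\<^sup>2 * d\<^sup>2 * (a + \<rho> / d * b)\<^sup>2" for a b
  proof -
    have "d * a + \<rho> * b = d * (a + \<rho> / d * b)" using d by (simp add: field_simps)
    then show ?thesis by (simp only: power_mult_distrib mult.assoc)
  qed
  show ?thesis
    using assms unfolding fas_channel_def d_def[symmetric] d(2)
    by (simp add: cmod_power2 eq distrib_left[of "\<sigma>\<^sup>2 * d\<^sup>2"] abs_of_pos[OF d(1)])
qed

lemma atLeastAtMost_1_insert: "1 \<le> M \<Longrightarrow> {1..M} = insert 1 {2..M::nat}"
  by auto

theorem theorem1:
  fixes P :: "'a measure"
    and N M :: nat
    and \<sigma> \<rho> \<gamma> :: real
    and x y :: "nat \<Rightarrow> nat \<Rightarrow> 'a \<Rightarrow> real"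
  assumes "prob_space P"
    and "N \<ge> 1" and "M \<ge> 1"
    and "\<sigma> > 0" and "\<bar>\<rho>\<bar> < 1"
    and indep: "prob_space.indep_vars P (\<lambda>_. borel)
           (case_sum (\<lambda>(m, n). x m n) (\<lambda>(m, n). y m n))
           (gauss_index N M <+> gauss_index N M)"
    and x_normal: "\<And>m n. (m, n) \<in> gauss_index N M \<Longrightarrow>
           distributed P lborel (x m n) (normal_density 0 (sqrt (1 / 2)))"
    and y_normal: "\<And>m n. (m, n) \<in> gauss_index N M \<Longrightarrow>
           distributed P lborel (y m n) (normal_density 0 (sqrt (1 / 2)))"
    and "\<gamma> > 0"
  shows "outage_prob P N M \<sigma> \<rho> x y \<gamma> =
     (LBINT t:{0..\<gamma>}. t ^ (N - 1) / (\<sigma> ^ (2 * N) * fact (N - 1)) * exp (- t / \<sigma>\<^sup>2)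
        * (1 - marcum_Q N (sqrt (2 * \<rho>\<^sup>2 * t / (\<sigma>\<^sup>2 * (1 - \<rho>\<^sup>2))))
                          (sqrt (2 * \<gamma> / (\<sigma>\<^sup>2 * (1 - \<rho>\<^sup>2))))) ^ (M - 1))"
proof -
  interpret prob_space P by fact
  obtain n where N: "N = Suc n" using \<open>N \<ge> 1\<close> by (cases N) auto
  have "\<rho>\<^sup>2 < 1" using \<open>\<bar>\<rho>\<bar> < 1\<close> by (simp add: abs_square_less_1)
  then have \<rho>: "0 < 1 - \<rho>\<^sup>2" by simp
  define W where "W = case_sum (\<lambda>(m, n). x m n) (\<lambda>(m, n). y m n)"
  \<comment> \<open>\<open>K m\<close> holds the \<open>2 * N\<close> indices of block
    \<open>m\<close>, \<open>Inl\<close> for real and \<open>Inr\<close> for imaginary parts. Block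
    0 belongs to port 1, and \<open>q\<close> sends an index to its reference counterpart.\<close>
  define K :: "nat \<Rightarrow> ((nat \<times> nat) + (nat \<times> nat)) set"
    where "K m = ({m} \<times> {1..N}) <+> ({m} \<times> {1..N})" for m
  define q :: "(nat \<times> nat) + (nat \<times> nat) \<Rightarrow> (nat \<times> nat) + (nat \<times> nat)"
    where "q = map_sum (\<lambda>(m, n). (0, n)) (\<lambda>(m, n). (0, n))"
  \<comment> \<open>\<open>c\<close> is the shift coefficient and \<open>r\<close> the threshold
    \<open>\<gamma>\<close> after division by the common factor of the gains of ports 2 to
    \<open>M\<close>.\<close>
  define c where "c = \<rho> / sqrt (1 - \<rho>\<^sup>2)"
  define r where "r = \<gamma> / (\<sigma>\<^sup>2 * (1 - \<rho>\<^sup>2))"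
  have c2: "c\<^sup>2 = \<rho>\<^sup>2 / (1 - \<rho>\<^sup>2)" using \<rho> by (simp add: c_def power_divide)
  have r: "0 \<le> r" using \<open>\<gamma> > 0\<close> \<rho> by (simp add: r_def)
  have I: "K 0 \<union> (\<Union>m\<in>{2..M}. K m) = gauss_index N M <+> gauss_index N M"
    by (auto simp: K_def gauss_index_def)
  \<comment> \<open>Two real variables per antenna index: the shape is \<open>N\<close>, written
    \<open>1 + real n\<close>.\<close>
  have cardK: "real (card (K 0)) / 2 = 1 + real n"
    unfolding K_def by (subst card_Plus) (auto simp: N)
  have sum_K: "(\<Sum>i\<in>K m. h i) = (\<Sum>n = 1..N. h (Inl (m, n)) + h (Inr (m, n)))" for m and h :: "_ \<Rightarrow> real"
    unfolding K_def by (simp add: sum.Plus sum.distrib sum.cartesian_product')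
  define F where "F l = (\<integral>\<^sup>+t\<in>{..<r}. nc_gamma_density (1 + real n) l t \<partial>lborel)" for l
  have [measurable]: "F \<in> borel_measurable borel" unfolding F_def by measurable
  have q_bij: "bij_betw q (K m) (K 0)" for m
    by (rule bij_betwI[where g="map_sum (\<lambda>(_, n). (m, n)) (\<lambda>(_, n). (m, n))"])
      (auto simp: q_def K_def)
  have W_distr: "distributed P lborel (W i) (normal_density 0 (sqrt (1 / 2)))"
    if "i \<in> gauss_index N M <+> gauss_index N M" for i
    using that x_normal y_normal by (auto simp: W_def)
  define G where "G t = indicator {0..\<gamma>} t * (t ^ (N - 1) / (\<sigma> ^ (2 * N) * fact (N - 1)) * exp (- t / \<sigma>\<^sup>2)
        * (1 - marcum_Q N (sqrt (2 * \<rho>\<^sup>2 * t / (\<sigma>\<^sup>2 * (1 - \<rho>\<^sup>2))))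
                          (sqrt (2 * \<gamma> / (\<sigma>\<^sup>2 * (1 - \<rho>\<^sup>2))))) ^ (M - 1))" for t
  have marcum_F: "ennreal (1 - marcum_Q N (sqrt (2 * \<rho>\<^sup>2 * t / (\<sigma>\<^sup>2 * (1 - \<rho>\<^sup>2))))
          (sqrt (2 * \<gamma> / (\<sigma>\<^sup>2 * (1 - \<rho>\<^sup>2))))) = F (c\<^sup>2 * t / \<sigma>\<^sup>2)"
    and marcum_le: "marcum_Q N (sqrt (2 * \<rho>\<^sup>2 * t / (\<sigma>\<^sup>2 * (1 - \<rho>\<^sup>2))))
          (sqrt (2 * \<gamma> / (\<sigma>\<^sup>2 * (1 - \<rho>\<^sup>2)))) \<le> 1" if "0 \<le> t" for t
  proof -
    \<comment> \<open>The Marcum arguments are those for rate \<open>c\<^sup>2 * s\<close> at the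
      normalized gain \<open>s = t / \<sigma>\<^sup>2\<close> and for threshold
      \<open>r\<close>.\<close>
    have args: "2 * \<rho>\<^sup>2 * t / (\<sigma>\<^sup>2 * (1 - \<rho>\<^sup>2)) = 2 * (c\<^sup>2 * t / \<sigma>\<^sup>2)" "2 * \<gamma> / (\<sigma>\<^sup>2 * (1 - \<rho>\<^sup>2)) = 2 * r"
      by (simp_all add: c2 r_def mult_ac)
    have "0 \<le> c\<^sup>2 * t / \<sigma>\<^sup>2" using that by simp
    note * = ennreal_one_minus_marcum_Q[OF this r, of n]
    show "ennreal (1 - marcum_Q N (sqrt (2 * \<rho>\<^sup>2 * t / (\<sigma>\<^sup>2 * (1 - \<rho>\<^sup>2))))
          (sqrt (2 * \<gamma> / (\<sigma>\<^sup>2 * (1 - \<rho>\<^sup>2))))) = F (c\<^sup>2 * t / \<sigma>\<^sup>2)"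
      "marcum_Q N (sqrt (2 * \<rho>\<^sup>2 * t / (\<sigma>\<^sup>2 * (1 - \<rho>\<^sup>2))))
          (sqrt (2 * \<gamma> / (\<sigma>\<^sup>2 * (1 - \<rho>\<^sup>2)))) \<le> 1"
      unfolding args F_def using * by (simp_all only: N)
  qed
  have G_nonneg: "0 \<le> G t" for t
    using marcum_le[of t] \<open>\<sigma> > 0\<close> unfolding G_def by (auto simp: indicator_def)
  \<comment> \<open>Measurability of the integrand is read off after the Marcum factor is expressed
    by the measurable \<open>F\<close>.\<close>
  have "G = (\<lambda>t. indicator {0..\<gamma>} t * (t ^ (N - 1) / (\<sigma> ^ (2 * N) * fact (N - 1)) * exp (- t / \<sigma>\<^sup>2)
        * enn2real (F (c\<^sup>2 * t / \<sigma>\<^sup>2)) ^ (M - 1)))"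
  proof
    fix t
    show "G t = indicator {0..\<gamma>} t * (t ^ (N - 1) / (\<sigma> ^ (2 * N) * fact (N - 1)) * exp (- t / \<sigma>\<^sup>2)
        * enn2real (F (c\<^sup>2 * t / \<sigma>\<^sup>2)) ^ (M - 1))"
      using marcum_F[of t] marcum_le[of t] unfolding G_def
      by (cases "t \<in> {0..\<gamma>}") (auto simp flip: marcum_F)
  qed
  then have G_meas: "G \<in> borel_measurable borel" by simp
  have gain_1: "fas_port_gain N \<sigma> \<rho> x y 1 \<omega> < \<gamma> \<longleftrightarrow> (\<Sum>i\<in>K 0. (W i \<omega>)\<^sup>2) < \<gamma> / \<sigma>\<^sup>2" for \<omega>
    unfolding fas_port_gain_def cmod_fas_channel_1 sum_K sum_distrib_left[symmetric]
    using \<open>\<sigma> > 0\<close> by (simp add: W_def field_simps)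
  have gain_m: "fas_port_gain N \<sigma> \<rho> x y m \<omega> < \<gamma> \<longleftrightarrow> (\<Sum>i\<in>K m. (W i \<omega> + c * W (q i) \<omega>)\<^sup>2) < r"
    if "m \<in> {2..M}" for m \<omega>
  proof -
    have "m \<noteq> 1" using that by auto
    then have "fas_port_gain N \<sigma> \<rho> x y m \<omega> = \<sigma>\<^sup>2 * (1 - \<rho>\<^sup>2) * (\<Sum>i\<in>K m. (W i \<omega> + c * W (q i) \<omega>)\<^sup>2)"
      unfolding fas_port_gain_def sum_K cmod_fas_channel[OF \<open>m \<noteq> 1\<close> \<open>\<bar>\<rho>\<bar> < 1\<close>]
      by (simp add: W_def q_def c_def sum_distrib_left)
    then show ?thesis using \<open>\<sigma> > 0\<close> \<rho> by (simp add: r_def pos_less_divide_eq mult.commute)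
  qed
  \<comment> \<open>A maximum of finitely many gains lies below \<open>\<gamma>\<close> exactly when
    each gain does.\<close>
  have event: "{\<omega> \<in> space P. fas_gain N M \<sigma> \<rho> x y \<omega> < \<gamma>} =
     {\<omega> \<in> space P. (\<Sum>i\<in>K 0. (W i \<omega>)\<^sup>2) < \<gamma> / \<sigma>\<^sup>2 \<and>
        (\<forall>m\<in>{2..M}. (\<Sum>i\<in>K m. (W i \<omega> + c * W (q i) \<omega>)\<^sup>2) < r)}"
    unfolding fas_gain_def atLeastAtMost_1_insert[OF \<open>M \<ge> 1\<close>]
    using gain_1 gain_m by auto
  have "emeasure P {\<omega> \<in> space P. fas_gain N M \<sigma> \<rho> x y \<omega> < \<gamma>} =
     (\<integral>\<^sup>+s. nc_gamma_density (1 + real n) 0 s *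
        (indicator {..<\<gamma> / \<sigma>\<^sup>2} s * F (c\<^sup>2 * s) ^ card {2..M}) \<partial>lborel)"
    unfolding event F_def cardK[symmetric]
  proof (rule emeasure_shifted_normal_blocks[where q=q and K=K])
    show "indep_vars (\<lambda>_. borel) W (K 0 \<union> (\<Union>m\<in>{2..M}. K m))"
      using indep unfolding I W_def .
    show "distributed P lborel (W i) (normal_density 0 (sqrt (1 / 2)))"
      if "i \<in> K 0 \<union> (\<Union>m\<in>{2..M}. K m)" for i
      using W_distr that unfolding I .
  qed (use q_bij in \<open>auto simp: disjoint_family_on_def K_def N\<close>)
  \<comment> \<open>Prepares the change of variable \<open>t = \<sigma>\<^sup>2 * s\<close> with
    Jacobian \<open>\<sigma>\<^sup>2\<close>.\<close>
  also have "\<dots> = (\<integral>\<^sup>+s. ennreal (\<sigma>\<^sup>2) * ennreal (G (0 + \<sigma>\<^sup>2 * s)) \<partial>lborel)"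
  proof (rule nn_integral_cong_AE)
    \<comment> \<open>Two null points are set aside: at 0 the Gamma density is set to 0, and at
      \<open>\<gamma> / \<sigma>\<^sup>2\<close> the strict event meets the closed interval of
      integration.\<close>
    have eq: "nc_gamma_density (1 + real n) 0 s * (indicator {..<\<gamma> / \<sigma>\<^sup>2} s * F (c\<^sup>2 * s) ^ card {2..M}) =
        ennreal (\<sigma>\<^sup>2) * ennreal (G (0 + \<sigma>\<^sup>2 * s))" if "s \<noteq> 0" "s \<noteq> \<gamma> / \<sigma>\<^sup>2" for s
    proof (cases "0 < s \<and> s < \<gamma> / \<sigma>\<^sup>2")
      case True
      let ?t = "\<sigma>\<^sup>2 * s"
      let ?Q = "marcum_Q N (sqrt (2 * \<rho>\<^sup>2 * ?t / (\<sigma>\<^sup>2 * (1 - \<rho>\<^sup>2)))) (sqrt (2 * \<gamma> / (\<sigma>\<^sup>2 * (1 - \<rho>\<^sup>2))))"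
      have mem: "?t \<in> {0..\<gamma>}" "0 \<le> ?t" using True \<open>\<sigma> > 0\<close> by (simp_all add: field_simps)
      \<comment> \<open>The power \<open>\<sigma> ^ (2 * N)\<close> is cancelled by
        \<open>N - 1\<close> factors from \<open>?t\<close> and one from the Jacobian.\<close>
      have "\<sigma>\<^sup>2 * (?t ^ (N - 1) / (\<sigma> ^ (2 * N) * fact (N - 1)) * exp (- ?t / \<sigma>\<^sup>2)) = gamma_density (1 + real n) s"
        unfolding power_mult using True \<open>\<sigma> > 0\<close>
        by (simp add: gamma_density_Suc N power_mult_distrib)
      then have "\<sigma>\<^sup>2 * G ?t = gamma_density (1 + real n) s * (1 - ?Q) ^ (M - 1)"
        using mem unfolding G_def by (simp only: indicator_simps mult_1 mult.assoc[symmetric])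
      moreover have "F (c\<^sup>2 * s) = ennreal (1 - ?Q)" "?Q \<le> 1"
        using marcum_F[OF mem(2)] marcum_le[OF mem(2)] \<open>\<sigma> > 0\<close> by simp_all
      ultimately show ?thesis
        using True \<open>\<sigma> > 0\<close> G_nonneg[of ?t]
        by (simp add: nc_gamma_density_0 ennreal_power ennreal_mult[symmetric] gamma_density_nonneg)
    next
      case False
      then have "s < 0 \<or> \<gamma> / \<sigma>\<^sup>2 < s" using that by auto
      then have "\<sigma>\<^sup>2 * s \<notin> {0..\<gamma>}"
        using \<open>\<sigma> > 0\<close> by (auto simp: field_simps mult_less_0_iff zero_le_mult_iff)
      then show ?thesis using \<open>s < 0 \<or> \<gamma> / \<sigma>\<^sup>2 < s\<close>
        by (auto simp: G_def nc_gamma_density_nonpos)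
    qed
    show "AE s in lborel. nc_gamma_density (1 + real n) 0 s * (indicator {..<\<gamma> / \<sigma>\<^sup>2} s * F (c\<^sup>2 * s) ^ card {2..M}) =
        ennreal (\<sigma>\<^sup>2) * ennreal (G (0 + \<sigma>\<^sup>2 * s))"
      using AE_lborel_singleton[of 0] AE_lborel_singleton[of "\<gamma> / \<sigma>\<^sup>2"] by eventually_elim (rule eq)
  qed
  also have "\<dots> = (\<integral>\<^sup>+t. ennreal (G t) \<partial>lborel)"
    using \<open>\<sigma> > 0\<close> G_meas by (subst nn_integral_real_affine[where c="\<sigma>\<^sup>2" and t=0]) (auto simp: nn_integral_cmult)
  finally have "outage_prob P N M \<sigma> \<rho> x y \<gamma> = enn2real (\<integral>\<^sup>+t. ennreal (G t) \<partial>lborel)"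
    by (simp add: outage_prob_def measure_def)
  also have "\<dots> = (\<integral>t. G t \<partial>lborel)"
    using G_meas G_nonneg by (intro integral_eq_nn_integral[symmetric]) auto
  finally show ?thesis
    unfolding G_def set_lebesgue_integral_def real_scaleR_def .
qed

end
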